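(* Let $N\ge 2$ be an integer. There is no integer $C$ such that for every integer $n\ge 0$ there exists an integer index $j\ge 0$ (depending on $n$ and $N$) with $$\sum_{i=0}^{2N} F(n+i) = C\cdot F(j).$$
   Context: The Fibonacci numbers are defined by $F(0)=0$, $F(1)=1$, $F(n)=F(n-1)+F(n-2)$ for $n\ge 2$. *)

theory Defs
  imports "HOL-Number_Theory.Fib"
begin

end

theory Submission
  imports Defs
begin

text \<open>Put \<open>a = F (2N-1)\<close> and \<open>b = F (2N)\<close>. The sum telescopes to \<open>F (n+2N+2) - F (n+1)\<close>, so
  \<open>n = 0\<close> and \<open>n = 1\<close> show that \<open>C\<close> divides \<open>a+2b-1\<close> and \<open>2a+3b-1\<close>, i.e. \<open>a \<equiv> -1\<close> and \<open>b \<equiv> 1\<close>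
  modulo \<open>C\<close>. Cassini's identity \<open>b\<^sup>2 - ab - a\<^sup>2 = -1\<close> then reads \<open>1 \<equiv> -1\<close>, whence \<open>C\<close> divides 2.
  For \<open>C = 1\<close> the value \<open>F (2N+2) - 1\<close> lies strictly between \<open>F (2N+1)\<close> and \<open>F (2N+2)\<close>; for \<open>C = 2\<close>
  it lies strictly between \<open>2 F (2N)\<close> and \<open>2 F (2N+1)\<close>.\<close>

lemma sum_fib_add: "(\<Sum>i = 0..k. int (fib (n + i))) = int (fib (n + k + 2)) - int (fib (n + 1))"
  by (induction k) (simp_all add: fib.simps(3))

theorem theorem5p3:
  fixes N :: nat
  assumes "N \<ge> 2"
  shows "\<not> (\<exists>C::int. \<forall>n::nat. \<exists>j::nat. (\<Sum>i = 0..2*N. int (fib (n + i))) = C * int (fib j))"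
proof
  assume "\<exists>C::int. \<forall>n::nat. \<exists>j::nat. (\<Sum>i = 0..2*N. int (fib (n + i))) = C * int (fib j)"
  then obtain C :: int
    where C: "\<And>n. \<exists>j. int (fib (n + 2*N + 2)) - int (fib (n + 1)) = C * int (fib j)"
    unfolding sum_fib_add by blast
  obtain k where N: "N = k + 2"
    using assms le_Suc_ex[of 2 N] by auto
  define a b where "a = int (fib (2*N-1))" and "b = int (fib (2*N))"
  have fibs: "int (fib (2*N+1)) = a + b" "int (fib (2*N+2)) = a + 2*b" "int (fib (2*N+3)) = 2*a + 3*b"
    unfolding a_def b_def N by (simp_all add: eval_nat_numeral)
  have a: "a \<ge> 2"
    using fib_mono[of 3 "2*N-1"] by (simp add: a_def N eval_nat_numeral)
  have b: "b \<ge> 3"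
    using fib_mono[of 4 "2*N"] by (simp add: b_def N eval_nat_numeral)
  obtain j where j: "a + 2*b - 1 = C * int (fib j)"
    using C[of 0] fibs(2) by (metis add_0 fib_1 of_nat_1)
  obtain j' where j': "2*a + 3*b - 1 = C * int (fib j')"
  proof -
    obtain j' where "int (fib (1 + 2*N + 2)) - int (fib (1 + 1)) = C * int (fib j')"
      using C by blast
    moreover have "1 + 2*N + 2 = 2*N + 3" "fib (1 + 1) = 1"
      by simp_all
    ultimately show thesis
      using that fibs(3) by (metis of_nat_1)
  qed
  define u v where "u = int (fib j)" and "v = int (fib j')"
  \<comment> \<open>The linear system for \<open>a\<close> and \<open>b\<close> has determinant -1,
    so its solution has integer coefficients.\<close>
  have a_eq: "a = C * (2*v - 3*u) - 1" and b_eq: "b = C * (2*u - v) + 1"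
    using j j' by (simp_all add: u_def v_def algebra_simps)
  \<comment> \<open>The even index \<open>2*k+2\<close> fixes the sign in Cassini's identity; its
    third Fibonacci number is \<open>b - a\<close>.\<close>
  have "2*N = Suc (Suc (2*k+2))" "2*N-1 = Suc (2*k+2)"
    by (simp_all add: N)
  then have "b * int (fib (2*k+2)) - a^2 = -1" "b = a + int (fib (2*k+2))"
    unfolding a_def b_def using fib_Cassini_int[of "2*k+2"] by simp_all
  then have "b^2 - a*b - a^2 = -1"
    by (simp add: algebra_simps power2_eq_square)
  moreover have "C dvd (b^2 - a*b - a^2) - 1"
    unfolding a_eq b_eq by (simp add: algebra_simps power2_eq_square)
  ultimately have "C dvd 2"
    by simp
  then have "\<bar>C\<bar> \<le> 2"
    by (simp add: zdvd_imp_le abs_le_iff dvd_imp_le_int)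
  moreover have "C > 0"
    using a b j by (smt (verit) mult_nonpos_nonneg of_nat_0_le_iff)
  ultimately consider "C = 1" | "C = 2"
    by linarith
  then show False
  proof cases
    case 1
    have "fib j \<le> fib (2*N+1) \<or> fib (2*N+2) \<le> fib j"
      using fib_mono[of j "2*N+1"] fib_mono[of "2*N+2" j] by linarith
    then show False
      using 1 j a b fibs by auto
  next
    case 2
    have "fib j \<le> fib (2*N) \<or> fib (2*N+1) \<le> fib j"
      using fib_mono[of j "2*N"] fib_mono[of "2*N+1" j] by linarith
    \<comment> \<open>The lower bound \<open>2*b < a + 2*b - 1\<close> needs \<open>a > 1\<close>.
      For \<open>N = 1\<close>, \<open>a = 1\<close> and \<open>C = 2\<close> works: the sum is
      \<open>2 * fib (n+2)\<close>.\<close>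
    then show False
      using 2 j a b b_def fibs by auto
  qed
qed

end
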